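(* Let $d\ge5$ be an integer. There are constants $N_d, c_d>0$ depending only on $d$, and for every $\epsilon>0$ a constant $c_{d,\epsilon}>0$ depending only on $d$ and $\epsilon$, such that the following holds. Let $m\ge1$, let $A\subset\mathbb{Z}^m$ be finite and nonempty, and suppose that $A$ contains a $d$-dimensional spherical Freiman model $D$ with $|D|\ge N_d$, i.e. a subset $D\subseteq A$ that is Freiman isomorphic, of some order $h\ge2$, to a subset $S\subseteq\mathcal{F}_{d,R^2}$ for some positive integer $R$. Put $\alpha:=|D|/|A|$. Let $R^{-1}\le\sigma\le c_d$, let $\mathcal{F}_{d,R^2}=\bigsqcup_{\theta\in\Theta}V_\theta$ be a standard $\sigma$-cap partition, and let $S=\bigsqcup_{\theta\in\Theta}S_\theta$, $S_\theta:=S\cap V_\theta$, be the induced partition. Then for every $\epsilon>0$ and every $\rho\in(0,1)$ there exists a subset $\Theta_{good}\subseteq\Theta$ such that $$\sum_{\theta\in\Theta_{good}}|S_\theta|\ge(1-\rho)|S|$$ and for every $\theta\in\Theta_{good}$ the following holds: if $\varnothing\ne Y\subseteq S_\theta$ and $\delta=|Y|/|S_\theta|$, then some nonzero $z\in Y+Y$ satisfies $$|Y\cap(z-Y)|\ge c_{d,\epsilon}\,\sigma^{d-3+\epsilon}\,\frac{\delta\rho\alpha}{\|A\|^2}\,|Y|.$$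
   Context: For a finite set $A\subset\mathbb{Z}^m$, the Fourier $L^1$ norm is $\|A\|:=\int_{\mathbb{T}^m}\big|\sum_{a\in A}e(a\cdot t)\big|\,dt$, where $e(x)=e^{2\pi i x}$ and $\mathbb{T}=\mathbb{R}/\mathbb{Z}$. For a positive integer $R$, $\mathcal{F}_{d,R^2}:=\{x\in\mathbb{Z}^d: |x|^2=R^2\}$ (Euclidean norm). A map $\phi:D\to D'$ between subsets of abelian groups is a Freiman $h$-homomorphism if $d_1+\cdots+d_h=d_{h+1}+\cdots+d_{2h}$ with all $d_i\in D$ implies $\phi(d_1)+\cdots+\phi(d_h)=\phi(d_{h+1})+\cdots+\phi(d_{2h})$. A Freiman $h$-isomorphism is a bijection for which this implication holds in both directions. Standard $\sigma$-cap partitions (defined for $R^{-1}\le\sigma\le c_d$, where $c_d>0$ is a sufficiently small constant depending only on $d$). For $\omega\in\mathbb{S}^{d-1}$ let $\kappa_\omega:=\{x\in\mathbb{S}^{d-1}:|x-\omega|\le\sigma\}$ and let $N_{\sigma^2}(\kappa_\omega):=\{y\in\mathbb{R}^d:\mathrm{dist}(y,\kappa_\omega)\le\sigma^2\}$. Cover $\mathbb{S}^{d-1}$ by a collection of $\asymp_d\sigma^{-(d-1)}$ such neighborhoods with overlap bounded by a constant depending only on $d$ (the implied constants and the overlap bound being fixed once and for all for each $d$), and let $\Theta$ be the index set of this collection. For every $m\in\mathcal{F}_{d,R^2}$ the point $m/R$ belongs to at least one neighborhood in the collection; assign $m$ to one such neighborhood (arbitrary choice) and let $V_\theta$ be the set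 of $m$ assigned to $\theta$. The resulting partition $\mathcal{F}_{d,R^2}=\bigsqcup_{\theta\in\Theta}V_\theta$ (some $V_\theta$ may be empty) is a standard $\sigma$-cap partition. Here $z-Y=\{z-y:y\in Y\}$. *)

theory Defs
  imports "HOL-Analysis.Analysis" "HOL-Library.Function_Algebras" "HOL-Library.Set_Algebras"
begin

text \<open>
  The dimension of the group containing \<open>A\<close> varies while the constants of the theorem stay
  fixed, so it cannot be a type: the lattice of rank \<open>m\<close> is the subgroup of
  \<^typ>\<open>nat \<Rightarrow> int\<close> (with pointwise addition) of functions supported on \<open>{..<m}\<close>.
\<close>

definition int_lattice :: "nat \<Rightarrow> (nat \<Rightarrow> int) set" where
  "int_lattice m = {a. \<forall>i\<ge>m. a i = 0}"

text \<open>The torus is represented by its fundamental domain, the half-open unit cube.\<close>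

definition torus_measure :: "nat \<Rightarrow> (nat \<Rightarrow> real) measure" where
  "torus_measure m = (\<Pi>\<^sub>M i\<in>{..<m}. restrict_space lborel {0..<1})"

definition fourier_L1_norm :: "nat \<Rightarrow> (nat \<Rightarrow> int) set \<Rightarrow> real" where
  "fourier_L1_norm m A =
     (LINT t|torus_measure m. cmod (\<Sum>a\<in>A. cis (2 * pi * (\<Sum>i<m. real_of_int (a i) * t i))))"

definition freiman_iso ::
    "nat \<Rightarrow> ('a::ab_group_add \<Rightarrow> 'b::ab_group_add) \<Rightarrow> 'a set \<Rightarrow> 'b set \<Rightarrow> bool" where
  "freiman_iso h \<phi> D D' \<longleftrightarrow> bij_betw \<phi> D D' \<and>
     (\<forall>x y :: nat \<Rightarrow> 'a. (\<forall>i<h. x i \<in> D \<and> y i \<in> D) \<longrightarrow>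
        ((\<Sum>i<h. x i) = (\<Sum>i<h. y i) \<longleftrightarrow> (\<Sum>i<h. \<phi> (x i)) = (\<Sum>i<h. \<phi> (y i))))"

definition real_vec :: "int ^ 'd \<Rightarrow> real ^ 'd" where
  "real_vec x = (\<chi> i. real_of_int (x $ i))"

definition lattice_sphere :: "nat \<Rightarrow> (int ^ 'd::finite) set" where
  "lattice_sphere R = {x. (norm (real_vec x))\<^sup>2 = (real R)\<^sup>2}"

definition spherical_freiman_model ::
    "(nat \<Rightarrow> int) set \<Rightarrow> (nat \<Rightarrow> int) set \<Rightarrow> nat \<Rightarrow> (int ^ 'd::finite) set \<Rightarrow> bool" where
  "spherical_freiman_model A D R S \<longleftrightarrow>
     D \<subseteq> A \<and> S \<subseteq> lattice_sphere R \<and> (\<exists>h\<ge>2. \<exists>\<phi>. freiman_iso h \<phi> D S)"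

definition cap :: "real \<Rightarrow> real ^ 'd \<Rightarrow> (real ^ 'd::finite) set" where
  "cap \<sigma> w = {x \<in> sphere 0 1. dist x w \<le> \<sigma>}"

definition cap_nbhd :: "real \<Rightarrow> real ^ 'd \<Rightarrow> (real ^ 'd::finite) set" where
  "cap_nbhd \<sigma> w = {y. infdist y (cap \<sigma> w) \<le> \<sigma>\<^sup>2}"

text \<open>
  The parameters \<open>a\<close>, \<open>b\<close> are the implied constants in the number of caps and \<open>K\<close> is the overlap
  bound. The finite index set is taken to consist of natural numbers, without loss of
  generality; \<open>w \<theta>\<close> is the centre of the cap with index \<open>\<theta>\<close>, and \<open>\<tau>\<close> is the arbitrary choice
  of a neighbourhood for each lattice point.
\<close>

definition standard_cap_partition ::
    "real \<Rightarrow> real \<Rightarrow> nat \<Rightarrow> nat \<Rightarrow> real \<Rightarrow> nat set \<Rightarrow> (nat \<Rightarrow> real ^ 'd::finite)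
       \<Rightarrow> (nat \<Rightarrow> (int ^ 'd) set) \<Rightarrow> bool" where
  "standard_cap_partition a b K R \<sigma> \<Theta> w V \<longleftrightarrow>
     finite \<Theta> \<and> w ` \<Theta> \<subseteq> sphere 0 1 \<and>
     sphere 0 1 \<subseteq> (\<Union>\<theta>\<in>\<Theta>. cap_nbhd \<sigma> (w \<theta>)) \<and>
     a / \<sigma> ^ (CARD('d) - 1) \<le> real (card \<Theta>) \<and>
     real (card \<Theta>) \<le> b / \<sigma> ^ (CARD('d) - 1) \<and>
     (\<forall>y. card {\<theta> \<in> \<Theta>. y \<in> cap_nbhd \<sigma> (w \<theta>)} \<le> K) \<and>
     (\<exists>\<tau>. (\<forall>x \<in> lattice_sphere R. \<tau> x \<in> \<Theta> \<and> real_vec x /\<^sub>R real R \<in> cap_nbhd \<sigma> (w (\<tau> x))) \<and>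
          (\<forall>\<theta>\<in>\<Theta>. V \<theta> = {x \<in> lattice_sphere R. \<tau> x = \<theta>}))"

end

theory Submission
  imports Defs
begin

text \<open>
  Write \<open>E\<close> for additive energy. Hoelder's inequality on the torus gives
  \<open>(\<Sum>\<^bsub>D\<^esub> g)\<^sup>4 \<le> \<parallel>A\<parallel>\<^sup>2 |A| E(g)\<close> for every nonnegative weight \<open>g\<close> on \<open>D\<close>, and the Freiman
  isomorphism carries \<open>E\<close> over to \<open>S\<close>. If \<open>\<theta>\<close> is bad, with witness \<open>Y\<close> of density \<open>\<delta>\<close> in \<open>S\<^sub>\<theta>\<close>, then
  \<open>f\<^sub>\<theta> = 1\<^sub>Y / \<delta>\<close> has mass \<open>|S\<^sub>\<theta>|\<close> and \<open>E(f\<^sub>\<theta>) \<le> \<kappa> |S\<^sub>\<theta>|\<^sup>3\<close> with \<open>\<kappa>\<close> a small multiple of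
  \<open>\<rho>\<alpha>/\<parallel>A\<parallel>\<^sup>2\<close>. In a relation \<open>x\<^sub>1 + x\<^sub>2 = x\<^sub>3 + x\<^sub>4\<close> any three caps determine the fourth up to boundedly
  many choices, so \<open>E(\<Sum>f\<^sub>\<theta>)\<close> is at most a constant times \<open>\<kappa> T\<^sup>3\<close>, where \<open>T\<close> is the total mass of the bad
  caps. Comparison with the lower bound \<open>T\<^sup>4 / (\<parallel>A\<parallel>\<^sup>2 |A|)\<close> yields \<open>T \<le> \<rho>|S|\<close>.
  The factor \<open>\<sigma>\<^bsup>d-3+\<epsilon>\<^esup>\<close> is merely bounded by 1, so \<open>c\<^sub>\<epsilon>\<close> is constant in \<open>\<epsilon>\<close>.
\<close>

subsection \<open>Additive energy\<close>

text \<open>Four separate weights are allowed because the energy of a sum of functions expands into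
  mixed terms. The additive relation enters as a 0-1 factor, so that every sum runs over the full
  product set.\<close>

definition quad_energy ::
    "'a::ab_group_add set \<Rightarrow> ('a \<Rightarrow> real) \<Rightarrow> ('a \<Rightarrow> real) \<Rightarrow> ('a \<Rightarrow> real) \<Rightarrow> ('a \<Rightarrow> real) \<Rightarrow> real" where
  "quad_energy X f g h k =
     (\<Sum>(x, y, z, w)\<in>X \<times> X \<times> X \<times> X. of_bool (x + y = z + w) * (f x * g y * h z * k w))"

abbreviation energy :: "'a::ab_group_add set \<Rightarrow> ('a \<Rightarrow> real) \<Rightarrow> real" where
  "energy X f \<equiv> quad_energy X f f f f"

lemma quad_energy_nonneg:
  assumes "\<And>x. 0 \<le> f x" "\<And>x. 0 \<le> g x" "\<And>x. 0 \<le> h x" "\<And>x. 0 \<le> k x"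
  shows "0 \<le> quad_energy X f g h k"
  unfolding quad_energy_def using assms by (intro sum_nonneg) auto

text \<open>Group the pairs by the common value \<open>z\<close> of \<open>u p\<close> and
  \<open>v q\<close>. A given pair can contribute only at \<open>z = u p\<close>, so it is enough
  that \<open>Z\<close> contains the image of \<open>u\<close>.\<close>

lemma sum_of_bool_eq_fibres:
  fixes a :: "'p \<Rightarrow> real" and b :: "'q \<Rightarrow> real"
  assumes "finite Z" "u ` P \<subseteq> Z"
  shows "(\<Sum>(p, q)\<in>P \<times> Q. of_bool (u p = v q) * (a p * b q)) =
    (\<Sum>z\<in>Z. (\<Sum>p\<in>P. of_bool (u p = z) * a p) * (\<Sum>q\<in>Q. of_bool (v q = z) * b q))"
proof -
  have "(\<Sum>z\<in>Z. (\<Sum>p\<in>P. of_bool (u p = z) * a p) * (\<Sum>q\<in>Q. of_bool (v q = z) * b q)) =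
     (\<Sum>z\<in>Z. \<Sum>pq\<in>P \<times> Q. (of_bool (u (fst pq) = z) * a (fst pq)) * (of_bool (v (snd pq) = z) * b (snd pq)))"
    by (simp add: sum_product sum.cartesian_product split_def)
  also have "\<dots> = (\<Sum>pq\<in>P \<times> Q. \<Sum>z\<in>Z. (of_bool (u (fst pq) = z) * a (fst pq)) * (of_bool (v (snd pq) = z) * b (snd pq)))"
    by (rule sum.swap)
  also have "\<dots> = (\<Sum>pq\<in>P \<times> Q. of_bool (u (fst pq) = v (snd pq)) * (a (fst pq) * b (snd pq)))"
  proof (rule sum.cong[OF refl])
    fix pq assume "pq \<in> P \<times> Q"
    then have "u (fst pq) \<in> Z" using assms(2) by auto
    have "(\<Sum>z\<in>Z. (of_bool (u (fst pq) = z) * a (fst pq)) * (of_bool (v (snd pq) = z) * b (snd pq)))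
      = (\<Sum>z\<in>Z. if u (fst pq) = z then of_bool (v (snd pq) = u (fst pq)) * (a (fst pq) * b (snd pq)) else 0)"
      by (intro sum.cong) auto
    also have "\<dots> = of_bool (v (snd pq) = u (fst pq)) * (a (fst pq) * b (snd pq))"
      using \<open>u (fst pq) \<in> Z\<close> assms(1) by (simp add: sum.delta')
    finally show "(\<Sum>z\<in>Z. (of_bool (u (fst pq) = z) * a (fst pq)) * (of_bool (v (snd pq) = z) * b (snd pq)))
      = of_bool (u (fst pq) = v (snd pq)) * (a (fst pq) * b (snd pq))" by (simp add: eq_commute)
  qed
  finally show ?thesis by (simp add: split_def)
qed

text \<open>All three sums are inner products of vectors of fibre sums indexed by the common values,
  so the ordinary Cauchy-Schwarz inequality applies.\<close>

lemma Cauchy_Schwarz_fibres: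
  fixes a :: "'p \<Rightarrow> real" and b :: "'q \<Rightarrow> real"
  assumes "finite P" "finite Q"
  shows "(\<Sum>(p, q)\<in>P \<times> Q. of_bool (u p = v q) * (a p * b q))\<^sup>2 \<le>
    (\<Sum>(p, p')\<in>P \<times> P. of_bool (u p = u p') * (a p * a p')) *
    (\<Sum>(q, q')\<in>Q \<times> Q. of_bool (v q = v q') * (b q * b q'))"
proof -
  define Z where "Z = u ` P \<union> v ` Q"
  have Z: "finite Z" "u ` P \<subseteq> Z" "v ` Q \<subseteq> Z" using assms by (auto simp: Z_def)
  show ?thesis
    unfolding sum_of_bool_eq_fibres[OF Z(1,2)] sum_of_bool_eq_fibres[OF Z(1,3)]
    using Cauchy_Schwarz_ineq_sum[of "\<lambda>z. (\<Sum>p\<in>P. of_bool (u p = z) * a p)" "\<lambda>z. (\<Sum>q\<in>Q. of_bool (v q = z) * b q)" Z]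
    by (simp add: power2_eq_square)
qed

text \<open>Quadruples are grouped by their common sum: the pairs \<open>(x, y)\<close> and
  \<open>(z, w)\<close> are the two sides of Cauchy-Schwarz.\<close>

lemma quad_energy_square_le:
  assumes "finite X"
  shows "(quad_energy X f g h k)\<^sup>2 \<le> quad_energy X f g f g * quad_energy X h k h k"
proof -
  have *: "quad_energy X f g h k =
    (\<Sum>(p, q)\<in>(X \<times> X) \<times> (X \<times> X). of_bool (fst p + snd p = fst q + snd q) *
       ((f (fst p) * g (snd p)) * (h (fst q) * k (snd q))))" for f g h k
    unfolding quad_energy_def
    by (rule sum.reindex_bij_witness[of _ "\<lambda>((x, y), (z, w)). (x, y, z, w)" "\<lambda>(x, y, z, w). ((x, y), (z, w))"])
       (auto simp: mult_ac)
  show ?thesis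
    unfolding * by (rule Cauchy_Schwarz_fibres) (use assms in auto)
qed

text \<open>The relation also reads \<open>x - z = w - y\<close>. Grouping by this difference puts
  both copies of \<open>f\<close> into one pair and both copies of \<open>g\<close> into the
  other.\<close>

lemma quad_energy_crossed_square_le:
  assumes "finite X"
  shows "(quad_energy X f g f g)\<^sup>2 \<le> energy X f * energy X g"
proof -
  have 1: "quad_energy X f g f g =
    (\<Sum>(p, q)\<in>(X \<times> X) \<times> (X \<times> X). of_bool (fst p - snd p = fst q - snd q) *
       ((f (fst p) * f (snd p)) * (g (fst q) * g (snd q))))"
    unfolding quad_energy_def
    by (rule sum.reindex_bij_witness[of _ "\<lambda>((x, z), (w, y)). (x, y, z, w)" "\<lambda>(x, y, z, w). ((x, z), (w, y))"])
       (auto simp: algebra_simps)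
  have 2: "energy X f =
    (\<Sum>(p, q)\<in>(X \<times> X) \<times> (X \<times> X). of_bool (fst p - snd p = fst q - snd q) *
       ((f (fst p) * f (snd p)) * (f (fst q) * f (snd q))))" for f
    unfolding quad_energy_def
    by (rule sum.reindex_bij_witness[of _ "\<lambda>((x, z), (w, y)). (x, y, z, w)" "\<lambda>(x, y, z, w). ((x, z), (w, y))"])
       (auto simp: algebra_simps)
  show ?thesis
    unfolding 1 2 by (rule Cauchy_Schwarz_fibres) (use assms in auto)
qed

text \<open>Separating first by sums and then by differences leaves four unmixed energies. This is
  the counterpart of Hoelder's inequality for a product of four functions in
  \<open>L^4\<close>.\<close>

lemma quad_energy_power4_le:
  assumes "finite X"
    and "\<And>x. 0 \<le> f x" "\<And>x. 0 \<le> g x" "\<And>x. 0 \<le> h x" "\<And>x. 0 \<le> k x"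
  shows "quad_energy X f g h k ^ 4 \<le> energy X f * energy X g * energy X h * energy X k"
proof -
  have "quad_energy X f g h k ^ 4 = ((quad_energy X f g h k)\<^sup>2)\<^sup>2" by simp
  also have "\<dots> \<le> (quad_energy X f g f g * quad_energy X h k h k)\<^sup>2"
    using quad_energy_square_le[OF assms(1)] by (intro power_mono) auto
  also have "\<dots> = (quad_energy X f g f g)\<^sup>2 * (quad_energy X h k h k)\<^sup>2" by (simp add: power_mult_distrib)
  also have "\<dots> \<le> (energy X f * energy X g) * (energy X h * energy X k)"
    using assms by (intro mult_mono quad_energy_crossed_square_le mult_nonneg_nonneg quad_energy_nonneg) auto
  finally show ?thesis by (simp add: mult_ac)
qed

lemma sum_prod4:
  fixes p q r s :: "'i \<Rightarrow> 'b::semiring_0"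
  shows "sum p B * sum q B * sum r B * sum s B = (\<Sum>(i, j, k, l)\<in>B \<times> B \<times> B \<times> B. p i * q j * r k * s l)"
proof -
  have "sum p B * (sum q B * (sum r B * sum s B)) = (\<Sum>(i, j, k, l)\<in>B \<times> B \<times> B \<times> B. p i * (q j * (r k * s l)))"
    by (simp only: sum_product sum.cartesian_product) (simp add: split_def sum_product sum.cartesian_product)
  then show ?thesis by (simp add: mult.assoc)
qed

lemma energy_sum:
  assumes "finite B"
  shows "energy X (\<lambda>x. \<Sum>i\<in>B. f i x) =
    (\<Sum>(i, j, k, l)\<in>B \<times> B \<times> B \<times> B. quad_energy X (f i) (f j) (f k) (f l))"
  unfolding quad_energy_def sum_prod4
  by (subst (2) split_def, subst split_def, simp add: sum_distrib_left split_def, rule sum.swap)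

text \<open>The weight does not involve \<open>l\<close>, so the innermost sum only counts the
  admissible \<open>l\<close>.\<close>

lemma sum_of_bool_triple_le:
  fixes s :: "'i \<Rightarrow> real"
  assumes "finite B" "\<And>i. i \<in> B \<Longrightarrow> 0 \<le> s i"
    and "\<And>i j k. card {l \<in> B. P i j k l} \<le> M"
  shows "(\<Sum>(i, j, k, l)\<in>B \<times> B \<times> B \<times> B. of_bool (P i j k l) * (s i * s j * s k)) \<le> real M * sum s B ^ 3"
proof -
  have "(\<Sum>(i, j, k, l)\<in>B \<times> B \<times> B \<times> B. of_bool (P i j k l) * (s i * s j * s k))
    = (\<Sum>i\<in>B. \<Sum>j\<in>B. \<Sum>k\<in>B. \<Sum>l\<in>B. of_bool (P i j k l) * (s i * s j * s k))"
    by (simp add: sum.cartesian_product split_def)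
  also have "\<dots> = (\<Sum>i\<in>B. \<Sum>j\<in>B. \<Sum>k\<in>B. real (card {l \<in> B. P i j k l}) * (s i * s j * s k))"
    using assms(1) by (simp flip: sum_distrib_right add: sum_of_bool_eq Int_def conj_commute)
  also have "\<dots> \<le> (\<Sum>i\<in>B. \<Sum>j\<in>B. \<Sum>k\<in>B. real M * (s i * s j * s k))"
    using assms by (intro sum_mono mult_right_mono) auto
  also have "\<dots> = real M * sum s B ^ 3"
    by (simp add: power3_eq_cube sum_distrib_left sum_distrib_right mult_ac)
  finally show ?thesis .
qed

section \<open>Freiman invariance and upper bounds for the energy\<close>

text \<open>Relations with \<open>h\<close> summands reduce to two summands: both sides are padded
  with \<open>h - 2\<close> copies of \<open>x\<close>, which cancel.\<close>

lemma freiman_iso_add_eq_iff: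
  assumes "freiman_iso h \<phi> D S" "2 \<le> h" "x \<in> D" "y \<in> D" "z \<in> D" "w \<in> D"
  shows "x + y = z + w \<longleftrightarrow> \<phi> x + \<phi> y = \<phi> z + \<phi> w"
proof -
  define p where "p a b i = (if i = 0 then a else if i = 1 then b else x)" for a b and i :: nat
  have sum: "(\<Sum>i<h. \<psi> (p a b i)) = \<psi> a + \<psi> b + (\<Sum>i\<in>{2..<h}. \<psi> x)" for a b and \<psi> :: "'a \<Rightarrow> 'c::ab_group_add"
  proof -
    have "{..<h} = insert 0 (insert 1 {2..<h})" using assms(2) by auto
    then show ?thesis by (simp add: p_def add.assoc)
  qed
  have "(\<forall>i<h. p x y i \<in> D \<and> p z w i \<in> D)" using assms by (auto simp: p_def)
  then have "(\<Sum>i<h. p x y i) = (\<Sum>i<h. p z w i) \<longleftrightarrow> (\<Sum>i<h. \<phi> (p x y i)) = (\<Sum>i<h. \<phi> (p z w i))"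
    using assms(1) unfolding freiman_iso_def by blast
  then show ?thesis using sum[of "\<lambda>x. x"] by (simp add: sum)
qed

lemma energy_freiman_iso:
  assumes "freiman_iso h \<phi> D S" "2 \<le> h"
  shows "energy D (\<lambda>x. f (\<phi> x)) = energy S f"
proof -
  have bij: "bij_betw \<phi> D S" using assms by (simp add: freiman_iso_def)
  let ?\<psi> = "the_inv_into D \<phi>"
  have inv: "?\<psi> s \<in> D" "\<phi> (?\<psi> s) = s" if "s \<in> S" for s
    using bij that by (auto simp: bij_betw_def the_inv_into_into f_the_inv_into_f)
  have inv': "\<phi> x \<in> S" "?\<psi> (\<phi> x) = x" if "x \<in> D" for x
    using bij that by (auto simp: bij_betw_def the_inv_into_f_f)
  show ?thesis
    unfolding quad_energy_def
    by (rule sum.reindex_bij_witness[of _ "\<lambda>(x, y, z, w). (?\<psi> x, ?\<psi> y, ?\<psi> z, ?\<psi> w)" "\<lambda>(x, y, z, w). (\<phi> x, \<phi> y, \<phi> z, \<phi> w)"])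
       (auto simp: inv inv' freiman_iso_add_eq_iff[OF assms])
qed

text \<open>For fixed \<open>x\<close> and \<open>y\<close> in \<open>Y\<close>, the solutions of
  \<open>x + y = z + w\<close> in \<open>Y\<close> correspond to the points of \<open>Y\<close> that
  also lie in \<open>(x + y) - Y\<close>. The uniform bound \<open>\<mu>\<close> is paid once for
  each of the \<open>(card Y)^2\<close> pairs.\<close>

lemma energy_indicator_le:
  fixes Y :: "'a::ab_group_add set"
  assumes "finite X" "Y \<subseteq> X"
    and r: "\<And>x y. x \<in> Y \<Longrightarrow> y \<in> Y \<Longrightarrow> real (card (Y \<inter> (\<lambda>u. (x + y) - u) ` Y)) \<le> \<mu>"
  shows "energy X (\<lambda>x. c * indicator Y x) \<le> c ^ 4 * (\<mu> * (real (card Y))\<^sup>2)"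
proof -
  have "finite Y" using assms finite_subset by blast
  have "energy X (\<lambda>x. c * indicator Y x) = (\<Sum>(x, y, z, w)\<in>Y \<times> Y \<times> Y \<times> Y. of_bool (x + y = z + w) * c ^ 4)"
    unfolding quad_energy_def using assms(1,2)
    by (intro sum.mono_neutral_cong_right) (auto simp: indicator_def power4_eq_xxxx)
  also have "\<dots> = (\<Sum>x\<in>Y. \<Sum>y\<in>Y. \<Sum>z\<in>Y. \<Sum>w\<in>Y. of_bool (x + y = z + w) * c ^ 4)"
    by (simp add: sum.cartesian_product split_def)
  also have "\<dots> = (\<Sum>x\<in>Y. \<Sum>y\<in>Y. c ^ 4 * real (card (Y \<inter> (\<lambda>u. (x + y) - u) ` Y)))"
  proof (intro sum.cong refl)
    fix x y assume "x \<in> Y" "y \<in> Y"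
    have "(\<Sum>z\<in>Y. \<Sum>w\<in>Y. of_bool (x + y = z + w) * c ^ 4) = (\<Sum>z\<in>Y. \<Sum>w\<in>Y. if w = x + y - z then c ^ 4 else 0)"
      by (intro sum.cong) (auto simp: algebra_simps)
    also have "\<dots> = (\<Sum>z\<in>Y. if x + y - z \<in> Y then c ^ 4 else 0)"
      using \<open>finite Y\<close> by (simp add: sum.delta)
    also have "\<dots> = c ^ 4 * real (card {z \<in> Y. x + y - z \<in> Y})"
      using \<open>finite Y\<close> by (simp add: sum.If_cases Int_def)
    also have "{z \<in> Y. x + y - z \<in> Y} = Y \<inter> (\<lambda>u. (x + y) - u) ` Y"
      by (auto simp: image_iff algebra_simps intro!: bexI[of _ "x + y - _"])
    finally show "(\<Sum>z\<in>Y. \<Sum>w\<in>Y. of_bool (x + y = z + w) * c ^ 4) = c ^ 4 * real (card (Y \<inter> (\<lambda>u. (x + y) - u) ` Y))" .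
  qed
  also have "\<dots> \<le> (\<Sum>x\<in>Y. \<Sum>y\<in>Y. c ^ 4 * \<mu>)"
    using r by (intro sum_mono mult_left_mono) auto
  also have "\<dots> = c ^ 4 * (\<mu> * (real (card Y))\<^sup>2)" by (simp add: power2_eq_square)
  finally show ?thesis .
qed

text \<open>
  Any three of the four indices of an additive quadruple determine the fourth up to \<open>M\<close> choices.
  This makes the energy of \<open>\<Sum>i. f i\<close> comparable to that of its pieces, with no loss in their number.
\<close>

lemma energy_sum_localized_le:
  fixes f :: "'i \<Rightarrow> 'a::ab_group_add \<Rightarrow> real" and w :: "'i \<Rightarrow> 'v::real_normed_vector"
  assumes fin: "finite X" "finite B" and f: "\<And>i x. 0 \<le> f i x" and s: "\<And>i. 0 \<le> s i" and \<kappa>: "0 \<le> \<kappa>"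
    and energy: "\<And>i. i \<in> B \<Longrightarrow> energy X (f i) \<le> \<kappa> * s i ^ 3"
    and loc: "\<And>i j k l x y z u. \<lbrakk>i \<in> B; j \<in> B; k \<in> B; l \<in> B; f i x \<noteq> 0; f j y \<noteq> 0; f k z \<noteq> 0; f l u \<noteq> 0;
        x + y = z + u\<rbrakk> \<Longrightarrow> norm (w i + w j - w k - w l) \<le> r"
    and M: "\<And>p. card {i \<in> B. norm (w i - p) \<le> r} \<le> M"
  shows "energy X (\<lambda>x. \<Sum>i\<in>B. f i x) \<le> 4 * real M * \<kappa> * sum s B ^ 3"
proof -
  \<comment> \<open>The centres satisfy the additive relation up to \<open>r\<close>; by
    \<open>loc\<close>, the mixed energy vanishes otherwise.\<close>
  define C where "C i j k l \<longleftrightarrow> norm (w i + w j - w k - w l) \<le> r" for i j k l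
  \<comment> \<open>Each product omits one index, the one that will be determined by the other
    three.\<close>
  define t where "t i j k l = s i * s j * s k + s i * s j * s l + s i * s k * s l + s j * s k * s l" for i j k l
  have quad: "quad_energy X (f i) (f j) (f k) (f l) \<le> \<kappa> * (of_bool (C i j k l) * t i j k l)"
    if B: "i \<in> B" "j \<in> B" "k \<in> B" "l \<in> B" for i j k l
  proof (cases "C i j k l")
    case False
    then have "quad_energy X (f i) (f j) (f k) (f l) = 0"
      unfolding quad_energy_def C_def using loc[OF B] by (intro sum.neutral) fastforce
    then show ?thesis using False by simp
  next
    case True
    have t: "s i * s j * s k \<le> t i j k l" "s i * s j * s l \<le> t i j k l"
      "s i * s k * s l \<le> t i j k l" "s j * s k * s l \<le> t i j k l"
      using s by (auto simp: t_def)
    have t0: "0 \<le> t i j k l" using s by (auto simp: t_def)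
    have "quad_energy X (f i) (f j) (f k) (f l) ^ 4 \<le> energy X (f i) * energy X (f j) * energy X (f k) * energy X (f l)"
      using fin f by (intro quad_energy_power4_le) auto
    also have "\<dots> \<le> (\<kappa> * s i ^ 3) * (\<kappa> * s j ^ 3) * (\<kappa> * s k ^ 3) * (\<kappa> * s l ^ 3)"
      using energy B f s \<kappa> by (intro mult_mono mult_nonneg_nonneg quad_energy_nonneg) auto
    \<comment> \<open>Every index occurs in exactly three of the four triple products, so the cubes
      regroup exactly into these. Each is at most \<open>t i j k l\<close>, and a fourth root
      finishes the bound.\<close>
    also have "\<dots> = \<kappa> ^ 4 * ((s i * s j * s k) * (s i * s j * s l) * (s i * s k * s l) * (s j * s k * s l))"
      by (simp add: power4_eq_xxxx power3_eq_cube mult_ac)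
    also have "\<dots> \<le> \<kappa> ^ 4 * (t i j k l * t i j k l * t i j k l * t i j k l)"
      using t t0 s \<kappa> by (intro mult_left_mono mult_mono mult_nonneg_nonneg) auto
    also have "\<dots> = (\<kappa> * t i j k l) ^ 4" by (simp add: power4_eq_xxxx mult_ac)
    finally have "quad_energy X (f i) (f j) (f k) (f l) \<le> \<kappa> * t i j k l"
      using t0 \<kappa> by - (rule power_le_imp_le_base[of _ 3], simp_all)
    then show ?thesis using True by simp
  qed
  have fibres: "card {l \<in> B. C i j k l} \<le> M" "card {k \<in> B. C i j k l} \<le> M"
    "card {j \<in> B. C i j k l} \<le> M" "card {i \<in> B. C i j k l} \<le> M" for i j k l
  proof -
    \<comment> \<open>Solving for any one centre turns \<open>C\<close> into membership in a ball of
      radius \<open>r\<close>, where \<open>M\<close> bounds the number of centres.\<close>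
    have "C i j k l \<longleftrightarrow> norm (w l - (w i + w j - w k)) \<le> r" for l
      unfolding C_def by (subst norm_minus_commute) (rule refl)
    moreover have "C i j k l \<longleftrightarrow> norm (w k - (w i + w j - w l)) \<le> r" for k
      unfolding C_def by (subst (2) norm_minus_commute) (simp add: diff_diff_eq add.commute)
    moreover have "C i j k l \<longleftrightarrow> norm (w j - (w k + w l - w i)) \<le> r" for j
      unfolding C_def by (simp add: algebra_simps)
    moreover have "C i j k l \<longleftrightarrow> norm (w i - (w k + w l - w j)) \<le> r" for i
      unfolding C_def by (simp add: algebra_simps)
    ultimately show "card {l \<in> B. C i j k l} \<le> M" "card {k \<in> B. C i j k l} \<le> M"
      "card {j \<in> B. C i j k l} \<le> M" "card {i \<in> B. C i j k l} \<le> M"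
      using M by presburger+
  qed
  have "energy X (\<lambda>x. \<Sum>i\<in>B. f i x) \<le>
      (\<Sum>(i, j, k, l)\<in>B \<times> B \<times> B \<times> B. \<kappa> * (of_bool (C i j k l) * t i j k l))"
    unfolding energy_sum[OF fin(2)] using quad by (intro sum_mono) auto
  also have "\<dots> = \<kappa> *
     ((\<Sum>(i, j, k, l)\<in>B \<times> B \<times> B \<times> B. of_bool (C i j k l) * (s i * s j * s k)) +
      (\<Sum>(i, j, k, l)\<in>B \<times> B \<times> B \<times> B. of_bool (C i j k l) * (s i * s j * s l)) +
      (\<Sum>(i, j, k, l)\<in>B \<times> B \<times> B \<times> B. of_bool (C i j k l) * (s i * s k * s l)) +
      (\<Sum>(i, j, k, l)\<in>B \<times> B \<times> B \<times> B. of_bool (C i j k l) * (s j * s k * s l)))"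
    by (simp add: t_def split_def sum_distrib_left sum.distrib algebra_simps)
  \<comment> \<open>The indices are reordered so that the one missing from the product comes last,
    as \<open>sum_of_bool_triple_le\<close> expects.\<close>
  also have "(\<Sum>(i, j, k, l)\<in>B \<times> B \<times> B \<times> B. of_bool (C i j k l) * (s i * s j * s l)) =
      (\<Sum>(i, j, l, k)\<in>B \<times> B \<times> B \<times> B. of_bool (C i j k l) * (s i * s j * s l))"
    by (rule sum.reindex_bij_witness[of _ "\<lambda>(i, j, l, k). (i, j, k, l)" "\<lambda>(i, j, k, l). (i, j, l, k)"]) auto
  also have "(\<Sum>(i, j, k, l)\<in>B \<times> B \<times> B \<times> B. of_bool (C i j k l) * (s i * s k * s l)) =
      (\<Sum>(i, k, l, j)\<in>B \<times> B \<times> B \<times> B. of_bool (C i j k l) * (s i * s k * s l))"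
    by (rule sum.reindex_bij_witness[of _ "\<lambda>(i, k, l, j). (i, j, k, l)" "\<lambda>(i, j, k, l). (i, k, l, j)"]) auto
  also have "(\<Sum>(i, j, k, l)\<in>B \<times> B \<times> B \<times> B. of_bool (C i j k l) * (s j * s k * s l)) =
      (\<Sum>(j, k, l, i)\<in>B \<times> B \<times> B \<times> B. of_bool (C i j k l) * (s j * s k * s l))"
    by (rule sum.reindex_bij_witness[of _ "\<lambda>(j, k, l, i). (i, j, k, l)" "\<lambda>(i, j, k, l). (j, k, l, i)"]) auto
  also have "\<kappa> *
     ((\<Sum>(i, j, k, l)\<in>B \<times> B \<times> B \<times> B. of_bool (C i j k l) * (s i * s j * s k)) +
      (\<Sum>(i, j, l, k)\<in>B \<times> B \<times> B \<times> B. of_bool (C i j k l) * (s i * s j * s l)) +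
      (\<Sum>(i, k, l, j)\<in>B \<times> B \<times> B \<times> B. of_bool (C i j k l) * (s i * s k * s l)) +
      (\<Sum>(j, k, l, i)\<in>B \<times> B \<times> B \<times> B. of_bool (C i j k l) * (s j * s k * s l)))
    \<le> \<kappa> * (real M * sum s B ^ 3 + real M * sum s B ^ 3 + real M * sum s B ^ 3 + real M * sum s B ^ 3)"
    using fin s \<kappa> fibres by (intro mult_left_mono add_mono sum_of_bool_triple_le) auto
  finally show ?thesis by (simp add: mult_ac)
qed

subsection \<open>Trigonometric polynomials on the torus\<close>

text \<open>The integral of \<open>h * (u - s * v)^2\<close> is a nonnegative quadratic polynomial
  in \<open>s\<close>; a suitable value of \<open>s\<close> gives the inequality.\<close>

lemma weighted_Cauchy_Schwarz_integral:
  fixes h u v :: "'a \<Rightarrow> real"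
  assumes h: "\<And>x. 0 \<le> h x"
    and int: "integrable M (\<lambda>x. h x * (u x)\<^sup>2)" "integrable M (\<lambda>x. h x * (v x)\<^sup>2)"
      "integrable M (\<lambda>x. h x * (u x * v x))"
  shows "(LINT x|M. h x * (u x * v x))\<^sup>2 \<le> (LINT x|M. h x * (u x)\<^sup>2) * (LINT x|M. h x * (v x)\<^sup>2)"
proof -
  define U V I where UVI: "U = (LINT x|M. h x * (u x)\<^sup>2)" "V = (LINT x|M. h x * (v x)\<^sup>2)"
    "I = (LINT x|M. h x * (u x * v x))"
  have q: "0 \<le> U - 2 * s * I + s\<^sup>2 * V" for s
  proof -
    have "0 \<le> (LINT x|M. h x * (u x - s * v x)\<^sup>2)"
      using h by (intro Bochner_Integration.integral_nonneg) auto
    also have "\<dots> = (LINT x|M. h x * (u x)\<^sup>2 - 2 * s * (h x * (u x * v x)) + s\<^sup>2 * (h x * (v x)\<^sup>2))"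
      by (intro Bochner_Integration.integral_cong) (auto simp: power2_eq_square algebra_simps)
    also have "\<dots> = U - 2 * s * I + s\<^sup>2 * V"
      unfolding UVI using int by simp
    finally show ?thesis .
  qed
  have "V \<ge> 0" unfolding UVI using h by (intro Bochner_Integration.integral_nonneg) auto
  have "I\<^sup>2 \<le> U * V"
  proof (cases "V = 0")
    case True
    have "I = 0"
    proof (rule ccontr)
      assume "I \<noteq> 0"
      \<comment> \<open>For \<open>V = 0\<close> the polynomial is linear in \<open>s\<close>, and
        at this point it would equal -1.\<close>
      then show False using q[of "(U + 1) / (2 * I)"] True by (simp add: field_simps)
    qed
    then show ?thesis using True by simp
  next
    case False
    then have "V > 0" using \<open>V \<ge> 0\<close> by simp
    \<comment> \<open>This is the minimum of the quadratic, attained at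
      \<open>s = I / V\<close>.\<close>
    have "0 \<le> U - I\<^sup>2 / V"
      using q[of "I / V"] \<open>V > 0\<close> by (simp add: power2_eq_square field_simps)
    then show ?thesis using \<open>V > 0\<close> by (simp add: field_simps)
  qed
  then show ?thesis unfolding UVI .
qed

section \<open>Characters of the torus and their orthogonality\<close>

definition torus_char :: "nat \<Rightarrow> (nat \<Rightarrow> int) \<Rightarrow> (nat \<Rightarrow> real) \<Rightarrow> complex" where
  "torus_char m n t = cis (2 * pi * (\<Sum>i<m. real_of_int (n i) * t i))"

lemma torus_char_add: "torus_char m (n + k) t = torus_char m n t * torus_char m k t"
  by (simp add: torus_char_def cis_mult algebra_simps sum.distrib)

lemma torus_char_diff: "torus_char m (n - k) t = torus_char m n t * cnj (torus_char m k t)"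
  by (simp add: torus_char_def cis_mult cis_cnj algebra_simps sum_subtractf)

lemma norm_torus_char [simp]: "cmod (torus_char m n t) = 1"
  by (simp add: torus_char_def)

text \<open>Factoring over the coordinates reduces integrals over the torus to integrals over one
  unit interval.\<close>

lemma torus_char_prod: "torus_char m n t = (\<Prod>i<m. cis (2 * pi * real_of_int (n i) * t i))"
proof -
  have "cis (\<Sum>i\<in>I. f i) = (\<Prod>i\<in>I. cis (f i))" if "finite I" for I :: "nat set" and f
    using that by induction (auto simp: cis_mult[symmetric])
  then show ?thesis by (simp add: torus_char_def sum_distrib_left mult.assoc)
qed

abbreviation unit_measure :: "real measure" where
  "unit_measure \<equiv> restrict_space lborel {0..<1}"

lemma finite_measure_unit: "finite_measure unit_measure"
  by (rule finite_measureI) (simp add: emeasure_restrict_space space_restrict_space)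

lemma integrable_cis_unit: "integrable unit_measure (\<lambda>x. cis (c * x))"
proof -
  interpret finite_measure unit_measure by (rule finite_measure_unit)
  show ?thesis
    by (rule integrable_const_bound[where B = 1]) (auto intro!: measurable_restrict_space1 borel_measurable_continuous_onI continuous_intros)
qed

lemma integral_cis_unit:
  "integral\<^sup>L unit_measure (\<lambda>x. cis (2 * pi * real_of_int k * x)) = of_bool (k = 0)"
proof -
  have "integral\<^sup>L unit_measure (\<lambda>x. cis (2 * pi * real_of_int k * x))
    = (LINT x:{0..<1}|lborel. cis (2 * pi * real_of_int k * x))"
    by (simp add: integral_restrict_space set_lebesgue_integral_def)
  \<comment> \<open>The endpoint 1 is a null set; the closed interval is the form used by the
    fundamental theorem of calculus.\<close>
  also have "\<dots> = (LINT x:{0..1}|lborel. cis (2 * pi * real_of_int k * x))"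
    unfolding set_lebesgue_integral_def
  proof (rule Bochner_Integration.integral_cong_AE)
    have "AE x in lborel. (x::real) \<noteq> 1" by (rule AE_lborel_singleton)
    then show "AE x in lborel. indicat_real {0..<1} x *\<^sub>R cis (2 * pi * real_of_int k * x) =
        indicat_real {0..1} x *\<^sub>R cis (2 * pi * real_of_int k * x)"
      by eventually_elim (auto simp: indicator_def)
    have [measurable]: "(\<lambda>x. cis (2 * pi * real_of_int k * x)) \<in> borel_measurable borel"
      by (intro borel_measurable_continuous_onI continuous_intros)
    show "(\<lambda>x. indicat_real {0..<1} x *\<^sub>R cis (2 * pi * real_of_int k * x)) \<in> borel_measurable lborel"
      and "(\<lambda>x. indicat_real {0..1} x *\<^sub>R cis (2 * pi * real_of_int k * x)) \<in> borel_measurable lborel"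
      by measurable
  qed
  also have "\<dots> = of_bool (k = 0)"
  proof (cases "k = 0")
    case True
    then show ?thesis by (simp add: set_lebesgue_integral_def)
  next
    case False
    define c where "c = 2 * pi * real_of_int k"
    have "c \<noteq> 0" using False by (simp add: c_def)
    \<comment> \<open>The primitive takes the same value at both ends because \<open>c\<close> is a
      multiple of \<open>2 * pi\<close>.\<close>
    have "(LINT x:{0..1}|lborel. cis (c * x)) = (cis (c * 1) / (\<i> * c) - cis (c * 0) / (\<i> * c))"
      unfolding set_lebesgue_integral_def
    proof (rule integral_FTC_Icc)
      fix x :: real
      have "((\<lambda>z. exp (\<i> * (c * z)) / (\<i> * c)) has_field_derivative exp (\<i> * (c * x))) (at (complex_of_real x))"
        using \<open>c \<noteq> 0\<close> by (auto intro!: derivative_eq_intros simp: mult_ac)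
      from has_vector_derivative_real_field[OF this]
      show "((\<lambda>x. cis (c * x) / (\<i> * c)) has_vector_derivative cis (c * x)) (at x within {0..1})"
        by (simp add: cis_conv_exp)
    qed (auto intro!: continuous_intros)
    also have "cis (c * 1) = 1" by (simp add: c_def cis_multiple_2pi)
    finally show ?thesis using False by (simp add: c_def)
  qed
  finally show ?thesis .
qed

lemma product_sigma_finite_unit: "product_sigma_finite (\<lambda>i::nat. unit_measure)"
  using finite_measure_unit finite_measure.axioms(1) by (simp add: product_sigma_finite_def)

lemma integrable_torus_char: "integrable (torus_measure m) (torus_char m n)"
proof -
  interpret product_sigma_finite "\<lambda>i::nat. unit_measure" by (rule product_sigma_finite_unit)
  show ?thesis
    unfolding torus_measure_def torus_char_prod[abs_def]
    by (rule product_integrable_prod) (auto intro: integrable_cis_unit)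
qed

text \<open>The character sees only the coordinates below \<open>m\<close>; support in
  \<open>{..<m}\<close> turns their vanishing into \<open>n = 0\<close>.\<close>

lemma integral_torus_char:
  assumes "n \<in> int_lattice m"
  shows "integral\<^sup>L (torus_measure m) (torus_char m n) = of_bool (n = 0)"
proof -
  interpret product_sigma_finite "\<lambda>i::nat. unit_measure" by (rule product_sigma_finite_unit)
  have "integral\<^sup>L (torus_measure m) (torus_char m n) = (\<Prod>i<m. of_bool (n i = 0))"
    unfolding torus_measure_def torus_char_prod[abs_def]
    by (subst product_integral_prod) (auto intro: integrable_cis_unit simp: integral_cis_unit)
  also have "\<dots> = of_bool (n = 0)"
  proof (cases "n = 0")
    case False
    then obtain i where "n i \<noteq> 0" by (auto simp: fun_eq_iff)
    moreover from this have "i < m" using assms by (metis (mono_tags, lifting) int_lattice_def mem_Collect_eq not_less)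
    ultimately show ?thesis using False by (auto simp: prod_zero_iff)
  qed auto
  finally show ?thesis .
qed

lemma int_lattice_add: "x \<in> int_lattice m \<Longrightarrow> y \<in> int_lattice m \<Longrightarrow> x + y \<in> int_lattice m"
  and int_lattice_diff: "x \<in> int_lattice m \<Longrightarrow> y \<in> int_lattice m \<Longrightarrow> x - y \<in> int_lattice m"
  by (auto simp: int_lattice_def)

text \<open>The frequencies form an indexed family, possibly with repetitions, so that products
  expanded over pairs or quadruples are covered.\<close>

lemma integral_trig_poly:
  assumes "\<And>i. i \<in> I \<Longrightarrow> n i \<in> int_lattice m"
  shows "(LINT t|torus_measure m. (\<Sum>i\<in>I. complex_of_real (c i) * torus_char m (n i) t)) =
    complex_of_real (\<Sum>i\<in>I. c i * of_bool (n i = 0))"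
  using assms
  by (subst Bochner_Integration.integral_sum)
     (auto simp: integral_torus_char integrable_torus_char intro!: sum.cong)

text \<open>The trivial character is the constant 1, and its integrability means finite total
  mass.\<close>

lemma finite_measure_torus: "finite_measure (torus_measure m)"
proof -
  have "integrable (torus_measure m) (\<lambda>t. 1 :: complex)"
    using integrable_torus_char[of m 0] by (simp add: torus_char_def[abs_def])
  then show ?thesis
    by (intro finite_measureI) (auto dest: Bochner_Integration.integrable_iff_bounded[THEN iffD1] simp: less_top)
qed

section \<open>Moments of trigonometric polynomials\<close>

definition trig_poly :: "nat \<Rightarrow> ((nat \<Rightarrow> int) \<Rightarrow> real) \<Rightarrow> (nat \<Rightarrow> int) set \<Rightarrow> (nat \<Rightarrow> real) \<Rightarrow> complex" where
  "trig_poly m g X t = (\<Sum>x\<in>X. complex_of_real (g x) * torus_char m x t)"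

lemma trig_poly_measurable [measurable]: "trig_poly m g X \<in> borel_measurable (torus_measure m)"
  unfolding trig_poly_def[abs_def]
  using borel_measurable_integrable[OF integrable_torus_char, measurable] by measurable

lemma norm_trig_poly_le: "cmod (trig_poly m g X t) \<le> (\<Sum>x\<in>X. \<bar>g x\<bar>)"
  unfolding trig_poly_def by (rule order_trans[OF norm_sum]) (simp add: norm_mult)

text \<open>Bounded functions on a finite measure space are integrable. Zero exponents are included,
  so one statement serves every integrand of the Hoelder argument.\<close>

lemma integrable_norm_trig_poly_prod:
  "integrable (torus_measure m) (\<lambda>t. cmod (trig_poly m f X t) ^ j * cmod (trig_poly m g Y t) ^ k)"
proof -
  interpret finite_measure "torus_measure m" by (rule finite_measure_torus)
  show ?thesis
    by (rule integrable_const_bound[where B = "(\<Sum>x\<in>X. \<bar>f x\<bar>) ^ j * (\<Sum>x\<in>Y. \<bar>g x\<bar>) ^ k"])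
       (auto simp: abs_mult intro!: AE_I2 mult_mono power_mono norm_trig_poly_le sum_nonneg)
qed

text \<open>Parseval's identity: by orthogonality only common frequencies survive. The coefficients
  are real, so the right side carries no conjugate.\<close>

lemma integral_trig_poly_mult_cnj:
  assumes "X \<subseteq> int_lattice m" "Y \<subseteq> int_lattice m" "finite X"
  shows "(LINT t|torus_measure m. trig_poly m f X t * cnj (trig_poly m g Y t)) =
    complex_of_real (\<Sum>y\<in>Y. of_bool (y \<in> X) * (f y * g y))"
proof -
  have "(LINT t|torus_measure m. trig_poly m f X t * cnj (trig_poly m g Y t)) =
    (LINT t|torus_measure m. (\<Sum>p\<in>X \<times> Y. complex_of_real (f (fst p) * g (snd p)) * torus_char m (fst p - snd p) t))"
    by (intro Bochner_Integration.integral_cong refl)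
       (simp add: trig_poly_def sum_product sum.cartesian_product torus_char_diff split_def mult_ac cnj_sum)
  also have "\<dots> = complex_of_real (\<Sum>p\<in>X \<times> Y. f (fst p) * g (snd p) * of_bool (fst p - snd p = 0))"
    using assms by (intro integral_trig_poly int_lattice_diff) auto
  also have "(\<Sum>p\<in>X \<times> Y. f (fst p) * g (snd p) * of_bool (fst p - snd p = 0)) =
      (\<Sum>y\<in>Y. \<Sum>x\<in>X. if x = y then f x * g y else 0)"
    by (subst sum.swap) (auto simp: sum.cartesian_product split_def intro!: sum.cong)
  also have "\<dots> = (\<Sum>y\<in>Y. of_bool (y \<in> X) * (f y * g y))"
    using assms(3) by (intro sum.cong) (auto simp: sum.delta)
  finally show ?thesis .
qed

lemma integral_norm_trig_poly_square:
  assumes "X \<subseteq> int_lattice m" "finite X"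
  shows "(LINT t|torus_measure m. (cmod (trig_poly m g X t))\<^sup>2) = (\<Sum>x\<in>X. (g x)\<^sup>2)"
proof -
  have "complex_of_real (LINT t|torus_measure m. (cmod (trig_poly m g X t))\<^sup>2) =
    (LINT t|torus_measure m. trig_poly m g X t * cnj (trig_poly m g X t))"
    by (simp only: integral_complex_of_real[symmetric] complex_norm_square)
  also have "\<dots> = complex_of_real (\<Sum>x\<in>X. (g x)\<^sup>2)"
    by (simp add: integral_trig_poly_mult_cnj assms power2_eq_square)
  finally show ?thesis by (simp only: of_real_eq_iff)
qed

text \<open>Expanding two factors and two conjugates gives characters of frequency
  \<open>x + y - (z + w)\<close>, and orthogonality keeps exactly the additive quadruples.\<close>

lemma integral_norm_trig_poly_power4:
  assumes "X \<subseteq> int_lattice m"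
  shows "(LINT t|torus_measure m. cmod (trig_poly m g X t) ^ 4) = energy X g"
proof -
  define c where "c = (\<lambda>(x, y, z, w). g x * g y * g z * g w)"
  define n where "n = (\<lambda>(x, y, z, w). x + y - (z + w) :: nat \<Rightarrow> int)"
  have *: "complex_of_real (cmod (trig_poly m g X t) ^ 4) =
      (\<Sum>p\<in>X \<times> X \<times> X \<times> X. complex_of_real (c p) * torus_char m (n p) t)" for t
  proof -
    let ?T = "trig_poly m g X t"
    have "complex_of_real (cmod ?T ^ 4) = (complex_of_real ((cmod ?T)\<^sup>2))\<^sup>2" by (simp flip: power_mult)
    also have "\<dots> = ?T * ?T * cnj ?T * cnj ?T"
      by (simp only: complex_norm_square) (simp add: power2_eq_square mult_ac)
    also have "\<dots> = (\<Sum>p\<in>X \<times> X \<times> X \<times> X. complex_of_real (c p) * torus_char m (n p) t)"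
      unfolding trig_poly_def cnj_sum sum_prod4
      by (intro sum.cong) (auto simp: c_def n_def torus_char_diff torus_char_add mult_ac)
    finally show ?thesis .
  qed
  have "complex_of_real (LINT t|torus_measure m. cmod (trig_poly m g X t) ^ 4) =
    (LINT t|torus_measure m. (\<Sum>p\<in>X \<times> X \<times> X \<times> X. complex_of_real (c p) * torus_char m (n p) t))"
    by (simp only: integral_complex_of_real[symmetric] *)
  also have "\<dots> = complex_of_real (\<Sum>p\<in>X \<times> X \<times> X \<times> X. c p * of_bool (n p = 0))"
    using assms by (intro integral_trig_poly) (auto simp: n_def intro!: int_lattice_add int_lattice_diff)
  also have "(\<Sum>p\<in>X \<times> X \<times> X \<times> X. c p * of_bool (n p = 0)) = energy X g"
    unfolding quad_energy_def by (intro sum.cong) (auto simp: c_def n_def)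
  finally show ?thesis by (simp only: of_real_eq_iff)
qed

text \<open>With \<open>a\<close> and \<open>b\<close> the moduli of the polynomials of
  \<open>A\<close> and \<open>g\<close>, this is Hoelder's inequality with exponents 2, 4, 4 for
  \<open>a * b = a^(1/2) * a^(1/2) * b\<close>, carried out as two applications of
  Cauchy-Schwarz.\<close>

lemma sum_power4_le_fourier_L1_norm_energy:
  assumes A: "A \<subseteq> int_lattice m" "finite A" and X: "X \<subseteq> A" and g: "\<And>x. 0 \<le> g x"
  shows "sum g X ^ 4 \<le> (fourier_L1_norm m A)\<^sup>2 * real (card A) * energy X g"
proof -
  define a where "a t = cmod (trig_poly m (\<lambda>_. 1) A t)" for t
  define b where "b t = cmod (trig_poly m g X t)" for t
  have Xl: "X \<subseteq> int_lattice m" using A X by auto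
  have int: "integrable (torus_measure m) (\<lambda>t. a t ^ j * b t ^ k)" for j k
    unfolding a_def b_def by (rule integrable_norm_trig_poly_prod)
  have nonneg: "0 \<le> a t" "0 \<le> b t" for t by (auto simp: a_def b_def)
  have L: "fourier_L1_norm m A = (LINT t|torus_measure m. a t)"
    by (simp add: fourier_L1_norm_def a_def trig_poly_def torus_char_def)
  \<comment> \<open>The polynomial of \<open>A\<close> has coefficient 1 at every point of
    \<open>X\<close>, so Parseval returns the total weight of \<open>g\<close>.\<close>
  have "complex_of_real (sum g X) =
      (LINT t|torus_measure m. trig_poly m (\<lambda>_. 1) A t * cnj (trig_poly m g X t))"
    using X by (subst integral_trig_poly_mult_cnj[OF A(1) Xl A(2)]) (auto intro!: arg_cong[of _ _ complex_of_real] sum.cong)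
  then have "cmod (complex_of_real (sum g X)) \<le> (LINT t|torus_measure m. a t * b t)"
    unfolding a_def b_def by (simp only: norm_mult[symmetric] complex_mod_cnj[of "trig_poly m g X _", symmetric]) (rule integral_norm_bound)
  then have 1: "sum g X \<le> (LINT t|torus_measure m. a t * b t)"
    using sum_nonneg[of X g] g by (simp only: norm_of_real)
  have 2: "(LINT t|torus_measure m. a t * b t)\<^sup>2 \<le> fourier_L1_norm m A * (LINT t|torus_measure m. a t * (b t)\<^sup>2)"
    using weighted_Cauchy_Schwarz_integral[of a "torus_measure m" "\<lambda>_. 1" b] int[of 1 0] int[of 1 1] int[of 1 2] nonneg
    by (simp add: L)
  have 3: "(LINT t|torus_measure m. a t * (b t)\<^sup>2)\<^sup>2 \<le> (LINT t|torus_measure m. (a t)\<^sup>2) * (LINT t|torus_measure m. b t ^ 4)"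
    using weighted_Cauchy_Schwarz_integral[of "\<lambda>_. 1" "torus_measure m" a "\<lambda>t. (b t)\<^sup>2"] int[of 2 0] int[of 1 2] int[of 0 4]
    by (simp flip: power_mult)
  have a2: "(LINT t|torus_measure m. (a t)\<^sup>2) = real (card A)"
    unfolding a_def by (subst integral_norm_trig_poly_square[OF A]) simp
  have b4: "(LINT t|torus_measure m. b t ^ 4) = energy X g"
    unfolding b_def by (rule integral_norm_trig_poly_power4[OF Xl])
  have "sum g X ^ 4 \<le> (LINT t|torus_measure m. a t * b t) ^ 4"
    using 1 g by (intro power_mono sum_nonneg) auto
  also have "\<dots> = ((LINT t|torus_measure m. a t * b t)\<^sup>2)\<^sup>2" by simp
  also have "\<dots> \<le> (fourier_L1_norm m A * (LINT t|torus_measure m. a t * (b t)\<^sup>2))\<^sup>2"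
    using 2 by (intro power_mono) auto
  also have "\<dots> = (fourier_L1_norm m A)\<^sup>2 * (LINT t|torus_measure m. a t * (b t)\<^sup>2)\<^sup>2"
    by (rule power_mult_distrib)
  also have "\<dots> \<le> (fourier_L1_norm m A)\<^sup>2 * (real (card A) * energy X g)"
    using 3 a2 b4 by (intro mult_left_mono) auto
  finally show ?thesis by (simp add: mult_ac)
qed

subsection \<open>Spherical caps\<close>

text \<open>After rescaling by \<open>1 / \<sigma>\<close>, the centres in question lie in a ball of
  radius 8, covered by finitely many balls of radius 1/2, their number being independent of
  \<open>\<sigma>\<close>. Centres in one small ball are within \<open>\<sigma>\<close> of each
  other, so a single centre lies in all their caps and the overlap bound \<open>K\<close> limits how
  many there are.\<close>

lemma card_centres_near_point_le:
  "\<exists>M::nat. \<forall>\<sigma> \<Theta> (w :: 'i \<Rightarrow> real ^ 'd::finite) p. 0 < \<sigma> \<longrightarrow> finite \<Theta> \<longrightarrow> w ` \<Theta> \<subseteq> sphere 0 1 \<longrightarrow>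
     (\<forall>y. card {\<theta> \<in> \<Theta>. y \<in> cap_nbhd \<sigma> (w \<theta>)} \<le> K) \<longrightarrow> card {\<theta> \<in> \<Theta>. norm (w \<theta> - p) \<le> 8 * \<sigma>} \<le> M"
proof -
  have "compact (cball (0 :: real ^ 'd) 8)" by simp
  then obtain F :: "(real ^ 'd) set" where F: "finite F" "cball 0 8 \<subseteq> (\<Union>k\<in>F. ball k (1/2))"
  proof (rule compactE_image)
    show "cball 0 8 \<subseteq> (\<Union>k\<in>UNIV. ball k (1/2) :: (real ^ 'd) set)"
      by (metis UNIV_I UN_I centre_in_ball half_gt_zero subsetI zero_less_one)
  qed auto
  have "card {\<theta> \<in> \<Theta>. norm (w \<theta> - p) \<le> 8 * \<sigma>} \<le> card F * K"
    if \<sigma>: "0 < \<sigma>" and \<Theta>: "finite \<Theta>" "w ` \<Theta> \<subseteq> sphere 0 1"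
      and K: "\<And>y. card {\<theta> \<in> \<Theta>. y \<in> cap_nbhd \<sigma> (w \<theta>)} \<le> K" for \<sigma> \<Theta> p and w :: "'i \<Rightarrow> real ^ 'd"
  proof -
    define T where "T k = {\<theta> \<in> \<Theta>. (w \<theta> - p) /\<^sub>R \<sigma> \<in> ball k (1/2)}" for k
    have fin: "finite (T k)" for k using \<Theta> by (simp add: T_def)
    have "card (T k) \<le> K" for k
    proof (cases "T k = {}")
      case False
      then obtain \<theta>0 where \<theta>0: "\<theta>0 \<in> T k" by blast
      have "T k \<subseteq> {\<theta> \<in> \<Theta>. w \<theta>0 \<in> cap_nbhd \<sigma> (w \<theta>)}"
      proof
        fix \<theta> assume \<theta>: "\<theta> \<in> T k"
        have "dist ((w \<theta>0 - p) /\<^sub>R \<sigma>) ((w \<theta> - p) /\<^sub>R \<sigma>) \<le> dist k ((w \<theta>0 - p) /\<^sub>R \<sigma>) + dist k ((w \<theta> - p) /\<^sub>R \<sigma>)"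
          by (rule dist_triangle3)
        then have "dist ((w \<theta>0 - p) /\<^sub>R \<sigma>) ((w \<theta> - p) /\<^sub>R \<sigma>) \<le> 1"
          using \<theta> \<theta>0 by (simp add: T_def)
        also have "dist ((w \<theta>0 - p) /\<^sub>R \<sigma>) ((w \<theta> - p) /\<^sub>R \<sigma>) = dist (w \<theta>0) (w \<theta>) / \<sigma>"
          using \<sigma> by (simp add: dist_norm divide_inverse mult.commute flip: scaleR_diff_right)
        finally have "dist (w \<theta>0) (w \<theta>) \<le> \<sigma>" using \<sigma> by simp
        then have "w \<theta>0 \<in> cap \<sigma> (w \<theta>)" using \<theta>0 \<Theta> by (auto simp: cap_def T_def)
        then show "\<theta> \<in> {\<theta> \<in> \<Theta>. w \<theta>0 \<in> cap_nbhd \<sigma> (w \<theta>)}" using \<theta> by (simp add: cap_nbhd_def T_def)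
      qed
      then have "card (T k) \<le> card {\<theta> \<in> \<Theta>. w \<theta>0 \<in> cap_nbhd \<sigma> (w \<theta>)}" using \<Theta> by (intro card_mono) auto
      then show ?thesis using K le_trans by blast
    qed simp
    moreover have "{\<theta> \<in> \<Theta>. norm (w \<theta> - p) \<le> 8 * \<sigma>} \<subseteq> (\<Union>k\<in>F. T k)"
    proof
      fix \<theta> assume \<theta>: "\<theta> \<in> {\<theta> \<in> \<Theta>. norm (w \<theta> - p) \<le> 8 * \<sigma>}"
      then have "(w \<theta> - p) /\<^sub>R \<sigma> \<in> cball 0 8" using \<sigma> by (simp add: pos_divide_le_eq divide_inverse_commute[symmetric])
      then obtain k where "k \<in> F" "(w \<theta> - p) /\<^sub>R \<sigma> \<in> ball k (1/2)" using F(2) by blast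
      then show "\<theta> \<in> (\<Union>k\<in>F. T k)" using \<theta> unfolding T_def by blast
    qed
    then have "card {\<theta> \<in> \<Theta>. norm (w \<theta> - p) \<le> 8 * \<sigma>} \<le> card (\<Union>k\<in>F. T k)"
      using F(1) fin by (intro card_mono) auto
    moreover have "card (\<Union>k\<in>F. T k) \<le> (\<Sum>k\<in>F. card (T k))" by (rule card_UN_le[OF F(1)])
    moreover have "(\<Sum>k\<in>F. card (T k)) \<le> card F * K"
      using calculation(1) sum_bounded_above[of F "\<lambda>k. card (T k)" K] by simp
    ultimately show ?thesis by linarith
  qed
  then show ?thesis by blast
qed

text \<open>The nearest point of the cap is within \<open>\<sigma>^2 \<le> \<sigma>\<close> of
  \<open>y\<close> and within \<open>\<sigma>\<close> of the centre.\<close>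

lemma cap_nbhd_dist_centre_le:
  assumes "w \<in> sphere 0 1" "0 < \<sigma>" "\<sigma> \<le> 1" "y \<in> cap_nbhd \<sigma> w"
  shows "norm (y - w) \<le> 2 * \<sigma>"
proof -
  have "cap \<sigma> w = sphere 0 1 \<inter> cball w \<sigma>" by (auto simp: cap_def dist_commute)
  then have "closed (cap \<sigma> w)" by auto
  \<comment> \<open>\<open>infdist\<close> to the empty set is 0 by convention, so the distance is
    informative only because the cap contains \<open>w\<close>.\<close>
  moreover have "cap \<sigma> w \<noteq> {}" using assms by (auto simp: cap_def intro!: exI[of _ w])
  ultimately obtain x where "x \<in> cap \<sigma> w" "infdist y (cap \<sigma> w) = dist y x"
    using infdist_attains_inf by blast
  then have "dist y x \<le> \<sigma>\<^sup>2" "dist x w \<le> \<sigma>" using assms by (auto simp: cap_def cap_nbhd_def)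
  moreover have "\<sigma>\<^sup>2 \<le> \<sigma>" using assms by (simp add: power2_eq_square mult_left_le)
  ultimately show ?thesis using dist_triangle[of y w x] by (simp add: dist_norm)
qed

section \<open>Bounding the total mass of the bad caps\<close>

lemma real_vec_add: "real_vec (x + y) = real_vec x + real_vec y"
  by (simp add: real_vec_def vec_eq_iff)

text \<open>The constants \<open>a\<close>, \<open>b\<close>, \<open>K\<close> of the cap covers are
  fixed before the constants of the conclusion, just as they are fixed once and for all for each
  dimension. The dimension is the cardinality of the type \<open>'d\<close>.\<close>

theorem theorem11:
  fixes a b :: real and K :: nat
  assumes dim: "CARD('d::finite) \<ge> 5"
    and cap_constants: "a > 0" "b > 0"
  shows "\<exists>(N::nat) (c::real) (c\<^sub>\<epsilon>::real \<Rightarrow> real).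
    N > 0 \<and> c > 0 \<and> (\<forall>\<epsilon>>0. c\<^sub>\<epsilon> \<epsilon> > 0) \<and>
    (\<forall>(m::nat) (A::(nat \<Rightarrow> int) set) (D::(nat \<Rightarrow> int) set) (R::nat) (S::(int ^ 'd) set)
       (\<sigma>::real) (\<Theta>::nat set) (w::nat \<Rightarrow> real ^ 'd) (V::nat \<Rightarrow> (int ^ 'd) set).
      m \<ge> 1 \<longrightarrow> A \<subseteq> int_lattice m \<longrightarrow> finite A \<longrightarrow> A \<noteq> {} \<longrightarrow>
      R > 0 \<longrightarrow> spherical_freiman_model A D R S \<longrightarrow> card D \<ge> N \<longrightarrow>
      1 / real R \<le> \<sigma> \<longrightarrow> \<sigma> \<le> c \<longrightarrow>
      standard_cap_partition a b K R \<sigma> \<Theta> w V \<longrightarrow>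
      (\<forall>\<epsilon> \<rho> :: real. \<epsilon> > 0 \<longrightarrow> 0 < \<rho> \<longrightarrow> \<rho> < 1 \<longrightarrow>
        (\<exists>\<Theta>\<^sub>g\<^sub>o\<^sub>o\<^sub>d \<subseteq> \<Theta>.
          (\<Sum>\<theta>\<in>\<Theta>\<^sub>g\<^sub>o\<^sub>o\<^sub>d. real (card (S \<inter> V \<theta>))) \<ge> (1 - \<rho>) * real (card S) \<and>
          (\<forall>\<theta>\<in>\<Theta>\<^sub>g\<^sub>o\<^sub>o\<^sub>d. \<forall>Y. Y \<noteq> {} \<longrightarrow> Y \<subseteq> S \<inter> V \<theta> \<longrightarrow>
            (let \<alpha> = real (card D) / real (card A);
                 \<delta> = real (card Y) / real (card (S \<inter> V \<theta>))
             in \<exists>z \<in> Y + Y. z \<noteq> 0 \<and>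
                  real (card (Y \<inter> (\<lambda>y. z - y) ` Y))
                    \<ge> c\<^sub>\<epsilon> \<epsilon> * \<sigma> powr (real CARD('d) - 3 + \<epsilon>)
                       * (\<delta> * \<rho> * \<alpha> / (fourier_L1_norm m A)\<^sup>2) * real (card Y))))))"
proof -
  obtain M where "\<forall>\<sigma> \<Theta> (w :: nat \<Rightarrow> real ^ 'd) p. 0 < \<sigma> \<longrightarrow> finite \<Theta> \<longrightarrow> w ` \<Theta> \<subseteq> sphere 0 1 \<longrightarrow>
     (\<forall>y. card {\<theta> \<in> \<Theta>. y \<in> cap_nbhd \<sigma> (w \<theta>)} \<le> K) \<longrightarrow> card {\<theta> \<in> \<Theta>. norm (w \<theta> - p) \<le> 8 * \<sigma>} \<le> M"
    using card_centres_near_point_le by (rule exE)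
  note M = this[rule_format]
  \<comment> \<open>The factor \<open>4 * M\<close> comes from
    \<open>energy_sum_localized_le\<close>; adding 1 keeps the denominator positive and gives
    \<open>4 * M * C < 1\<close>.\<close>
  define C :: real where "C = 1 / (4 * real M + 1)"
  have "C > 0" by (simp add: C_def add_pos_nonneg)
  show ?thesis
  \<comment> \<open>The bound 1/4 on \<open>\<sigma>\<close> prevents two points assigned to one cap
    from being antipodal.\<close>
  proof (rule exI[of _ 1], rule exI[of _ "1 / 4"], rule exI[of _ "\<lambda>_. C"], intro conjI allI impI)
    fix m :: nat and A D :: "(nat \<Rightarrow> int) set" and R :: nat and S :: "(int ^ 'd) set" and \<sigma> :: real
      and \<Theta> :: "nat set" and w :: "nat \<Rightarrow> real ^ 'd" and V :: "nat \<Rightarrow> (int ^ 'd) set" and \<epsilon> \<rho> :: real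
    assume "A \<subseteq> int_lattice m" "finite A" "A \<noteq> {}" "R > 0" and model: "spherical_freiman_model A D R S"
      and "1 / real R \<le> \<sigma>" "\<sigma> \<le> 1 / 4" and part: "standard_cap_partition a b K R \<sigma> \<Theta> w V"
      and "\<epsilon> > 0" "0 < \<rho>"
    have "\<sigma> > 0" using \<open>R > 0\<close> \<open>1 / real R \<le> \<sigma>\<close> by (meson of_nat_0_less_iff less_le_trans zero_less_divide_1_iff)
    obtain h \<phi> where \<phi>: "freiman_iso h \<phi> D S" "2 \<le> h" and "D \<subseteq> A" and S: "S \<subseteq> lattice_sphere R"
      using model unfolding spherical_freiman_model_def by blast
    have bij: "bij_betw \<phi> D S" using \<phi> by (simp add: freiman_iso_def)
    have "finite D" using \<open>D \<subseteq> A\<close> \<open>finite A\<close> finite_subset by blast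
    have "finite S" and card_S: "card D = card S"
      using bij \<open>finite D\<close> bij_betw_finite bij_betw_same_card by blast+
    obtain \<tau> where \<Theta>: "finite \<Theta>" "w ` \<Theta> \<subseteq> sphere 0 1"
      and overlap: "\<And>y. card {\<theta> \<in> \<Theta>. y \<in> cap_nbhd \<sigma> (w \<theta>)} \<le> K"
      and \<tau>: "\<And>x. x \<in> lattice_sphere R \<Longrightarrow> \<tau> x \<in> \<Theta> \<and> real_vec x /\<^sub>R real R \<in> cap_nbhd \<sigma> (w (\<tau> x))"
      and V: "\<And>\<theta>. \<theta> \<in> \<Theta> \<Longrightarrow> V \<theta> = {x \<in> lattice_sphere R. \<tau> x = \<theta>}"
      using part unfolding standard_cap_partition_def by blast
    define v where "v x = real_vec x /\<^sub>R real R" for x :: "int ^ 'd"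
    have v_add: "v (x + y) = v x + v y" for x y
      by (simp add: v_def real_vec_add scaleR_add_right)
    have near: "norm (v x - w \<theta>) \<le> 2 * \<sigma>" if "\<theta> \<in> \<Theta>" "x \<in> S \<inter> V \<theta>" for \<theta> x
      using that \<tau>[of x] V[of \<theta>] \<Theta>(2) \<open>\<sigma> > 0\<close> \<open>\<sigma> \<le> 1 / 4\<close> unfolding v_def
      by (intro cap_nbhd_dist_centre_le) auto
    \<comment> \<open>A bad cap is controlled only at nonzero \<open>z\<close>, so zero must be
      excluded as a sum within a cap: otherwise \<open>2 * w \<theta>\<close>, of norm 2, would have
      norm at most \<open>4 * \<sigma> \<le> 1\<close>.\<close>
    have sum_nonzero: "x + y \<noteq> 0" if "\<theta> \<in> \<Theta>" "x \<in> S \<inter> V \<theta>" "y \<in> S \<inter> V \<theta>" for \<theta> x y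
    proof
      assume "x + y = 0"
      moreover have "v 0 = 0" by (simp add: v_def real_vec_def vec_eq_iff)
      ultimately have "v x + v y = 0" by (simp flip: v_add)
      then have "norm (2 *\<^sub>R w \<theta>) = norm ((v x - w \<theta>) + (v y - w \<theta>))"
        by (simp add: algebra_simps scaleR_2 norm_minus_commute flip: norm_minus_cancel[of "w \<theta> + w \<theta>"])
      also have "\<dots> \<le> 1"
        using norm_triangle_ineq[of "v x - w \<theta>" "v y - w \<theta>"] near[OF that(1,2)] near[OF that(1,3)] \<open>\<sigma> \<le> 1 / 4\<close>
        by linarith
      finally show False using \<Theta>(2) that(1) by auto
    qed
    define L where "L = fourier_L1_norm m A"
    define \<alpha> where "\<alpha> = real (card D) / real (card A)"
    \<comment> \<open>The required lower bound is \<open>\<kappa> * \<delta> * card Y\<close>;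
      everything that does not depend on \<open>\<theta>\<close> and \<open>Y\<close> is collected
      here.\<close>
    define \<kappa> where "\<kappa> = C * \<sigma> powr (real CARD('d) - 3 + \<epsilon>) * (\<rho> * \<alpha> / L\<^sup>2)"
    define s where "s \<theta> = real (card (S \<inter> V \<theta>))" for \<theta>
    \<comment> \<open>This says that \<open>Y\<close> is a counterexample to the desired conclusion
      in the cap \<open>\<theta>\<close>.\<close>
    define bad where "bad \<theta> Y \<longleftrightarrow> Y \<noteq> {} \<and> Y \<subseteq> S \<inter> V \<theta> \<and>
      (\<forall>z\<in>Y + Y. z \<noteq> 0 \<longrightarrow> real (card (Y \<inter> (\<lambda>y. z - y) ` Y)) < \<kappa> * (real (card Y) / s \<theta>) * real (card Y))" for \<theta> Y
    define B where "B = {\<theta> \<in> \<Theta>. \<exists>Y. bad \<theta> Y}"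
    define Y where "Y \<theta> = (SOME Y. bad \<theta> Y)" for \<theta>
    have Y: "bad \<theta> (Y \<theta>)" if "\<theta> \<in> B" for \<theta>
      using that unfolding B_def Y_def by (auto intro: someI)
    have B: "finite B" "B \<subseteq> \<Theta>" using \<Theta> by (auto simp: B_def)
    have s: "0 \<le> s \<theta>" for \<theta> by (simp add: s_def)
    have "\<alpha> \<ge> 0" by (simp add: \<alpha>_def)
    then have \<kappa>: "\<kappa> \<ge> 0" using \<open>C > 0\<close> \<open>\<rho> > 0\<close> by (simp add: \<kappa>_def)
    have sum_s: "sum s \<Theta> = real (card S)"
    proof -
      have "S = (\<Union>\<theta>\<in>\<Theta>. S \<inter> V \<theta>)" using S \<tau> V by auto
      then have "card S = card (\<Union>\<theta>\<in>\<Theta>. S \<inter> V \<theta>)" by simp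
      also have "\<dots> = (\<Sum>\<theta>\<in>\<Theta>. card (S \<inter> V \<theta>))"
        using \<Theta>(1) \<open>finite S\<close> V by (intro card_UN_disjoint) auto
      finally show ?thesis by (simp add: s_def)
    qed
    \<comment> \<open>The indicator of \<open>Y \<theta>\<close> is divided by its density in the
      cap, so its mass is \<open>s \<theta>\<close> however sparse \<open>Y \<theta>\<close>
      is.\<close>
    define f where "f \<theta> x = s \<theta> / real (card (Y \<theta>)) * indicator (Y \<theta>) x" for \<theta> and x :: "int ^ 'd"
    have f_nonneg: "0 \<le> f \<theta> x" for \<theta> x by (simp add: f_def s)
    have Y_card: "0 < card (Y \<theta>)" "finite (Y \<theta>)" "Y \<theta> \<subseteq> S \<inter> V \<theta>" "0 < s \<theta>" if "\<theta> \<in> B" for \<theta>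
    proof -
      show "Y \<theta> \<subseteq> S \<inter> V \<theta>" using Y[OF that] by (simp add: bad_def)
      then show "finite (Y \<theta>)" using \<open>finite S\<close> by (meson finite_Int finite_subset)
      moreover have "Y \<theta> \<noteq> {}" using Y[OF that] by (simp add: bad_def)
      ultimately show "0 < card (Y \<theta>)" by (simp add: card_gt_0_iff)
      then show "0 < s \<theta>"
        using \<open>Y \<theta> \<subseteq> S \<inter> V \<theta>\<close> \<open>finite S\<close> unfolding s_def
        by (metis card_gt_0_iff finite_Int of_nat_0_less_iff subset_empty)
    qed
    have f_sum: "sum (f \<theta>) S = s \<theta>" if "\<theta> \<in> B" for \<theta>
    proof -
      have "sum (f \<theta>) S = s \<theta> / real (card (Y \<theta>)) * real (card (S \<inter> Y \<theta>))"
        using \<open>finite S\<close> unfolding f_def by (subst sum_distrib_left[symmetric]) (simp add: indicator_def)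
      also have "S \<inter> Y \<theta> = Y \<theta>" using Y_card(3)[OF that] by auto
      finally show ?thesis using Y_card(1)[OF that] by simp
    qed
    have f_energy: "energy S (f \<theta>) \<le> \<kappa> * s \<theta> ^ 3" if "\<theta> \<in> B" for \<theta>
    proof -
      let ?n = "real (card (Y \<theta>))"
      note Yc = Y_card[OF that]
      have "energy S (f \<theta>) \<le> (s \<theta> / ?n) ^ 4 * ((\<kappa> * (?n / s \<theta>) * ?n) * ?n\<^sup>2)"
        unfolding f_def[abs_def]
      proof (rule energy_indicator_le)
        fix x y assume "x \<in> Y \<theta>" "y \<in> Y \<theta>"
        then have "x + y \<in> Y \<theta> + Y \<theta>" "x + y \<noteq> 0"
          using sum_nonzero[of \<theta> x y] that B Yc(3) by auto
        then show "real (card (Y \<theta> \<inter> (\<lambda>u. (x + y) - u) ` Y \<theta>)) \<le> \<kappa> * (?n / s \<theta>) * ?n"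
          using Y[OF that] unfolding bad_def by force
      qed (use \<open>finite S\<close> Yc in auto)
      \<comment> \<open>All powers of \<open>?n\<close> cancel; the factor \<open>\<delta>\<close>
        in the threshold is what makes this possible.\<close>
      also have "\<dots> = \<kappa> * s \<theta> ^ 3"
        using Yc(1,4) by (auto simp: power4_eq_xxxx power3_eq_cube power2_eq_square)
      finally show ?thesis .
    qed
    define T where "T = sum s B"
    have "energy S (\<lambda>x. \<Sum>\<theta>\<in>B. f \<theta> x) \<le> 4 * real M * \<kappa> * T ^ 3"
      unfolding T_def
    \<comment> \<open>The radius is four times \<open>2 * \<sigma>\<close>: four rescaled points
      satisfy the relation exactly, and each is within \<open>2 * \<sigma>\<close> of its
      centre.\<close>
    proof (rule energy_sum_localized_le[where w = w and r = "8 * \<sigma>"])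
      fix i j k l x y z u
      assume ijkl: "i \<in> B" "j \<in> B" "k \<in> B" "l \<in> B" and "f i x \<noteq> 0" "f j y \<noteq> 0" "f k z \<noteq> 0" "f l u \<noteq> 0"
        and eq: "x + y = z + u"
      then have "x \<in> S \<inter> V i" "y \<in> S \<inter> V j" "z \<in> S \<inter> V k" "u \<in> S \<inter> V l"
        using Y_card(3) by (auto simp: f_def indicator_def split: if_splits)
      then have n: "norm (v x - w i) \<le> 2 * \<sigma>" "norm (v y - w j) \<le> 2 * \<sigma>" "norm (v z - w k) \<le> 2 * \<sigma>" "norm (v u - w l) \<le> 2 * \<sigma>"
        using near ijkl B by auto
      have "v x + v y = v z + v u" using eq by (simp flip: v_add)
      then have w_eq: "w i + w j - w k - w l = ((v z - w k) + (v u - w l)) - ((v x - w i) + (v y - w j))"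
        by (simp add: algebra_simps)
      show "norm (w i + w j - w k - w l) \<le> 8 * \<sigma>"
        unfolding w_eq
        using n norm_triangle_ineq4[of "(v z - w k) + (v u - w l)" "(v x - w i) + (v y - w j)"]
          norm_triangle_ineq[of "v z - w k" "v u - w l"] norm_triangle_ineq[of "v x - w i" "v y - w j"] by linarith
    next
      fix p
      have "card {i \<in> B. norm (w i - p) \<le> 8 * \<sigma>} \<le> card {i \<in> \<Theta>. norm (w i - p) \<le> 8 * \<sigma>}"
        using B \<Theta> by (intro card_mono) auto
      also have "\<dots> \<le> M" using M[OF \<open>\<sigma> > 0\<close> \<Theta> overlap] .
      finally show "card {i \<in> B. norm (w i - p) \<le> 8 * \<sigma>} \<le> M" .
    qed (use \<open>finite S\<close> B f_nonneg s \<kappa> f_energy in auto)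
    moreover have "T ^ 4 \<le> L\<^sup>2 * real (card A) * energy S (\<lambda>x. \<Sum>\<theta>\<in>B. f \<theta> x)"
    proof -
      \<comment> \<open>The mass is moved to \<open>D\<close> inside \<open>A\<close>, where the
        Fourier bound applies; the energy returns to \<open>S\<close> by Freiman invariance.\<close>
      have "T = (\<Sum>x\<in>S. \<Sum>\<theta>\<in>B. f \<theta> x)" by (subst sum.swap) (simp add: T_def f_sum)
      also have "\<dots> = (\<Sum>x\<in>D. \<Sum>\<theta>\<in>B. f \<theta> (\<phi> x))" by (rule sum.reindex_bij_betw[OF bij, symmetric])
      finally show ?thesis
        using sum_power4_le_fourier_L1_norm_energy[OF \<open>A \<subseteq> int_lattice m\<close> \<open>finite A\<close> \<open>D \<subseteq> A\<close>, of "\<lambda>x. \<Sum>\<theta>\<in>B. f \<theta> (\<phi> x)"]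
          f_nonneg energy_freiman_iso[OF \<phi>, of "\<lambda>x. \<Sum>\<theta>\<in>B. f \<theta> x"]
        by (simp add: sum_nonneg L_def)
    qed
    \<comment> \<open>Here \<open>L^2\<close> cancels and
      \<open>\<alpha> * card A = card D = card S\<close>. The power of \<open>\<sigma>\<close> is at
      most 1 because its exponent is positive. For \<open>L = 0\<close> the left side
      vanishes.\<close>
    moreover have "L\<^sup>2 * real (card A) * \<kappa> \<le> C * \<rho> * real (card S)"
    proof (cases "L = 0")
      case False
      have "\<sigma> powr (real CARD('d) - 3 + \<epsilon>) \<le> 1"
        using \<open>\<sigma> > 0\<close> \<open>\<sigma> \<le> 1 / 4\<close> \<open>\<epsilon> > 0\<close> dim by (intro powr_le1) auto
      then have "C * \<rho> * real (card S) * \<sigma> powr (real CARD('d) - 3 + \<epsilon>) \<le> C * \<rho> * real (card S)"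
        using \<open>C > 0\<close> \<open>\<rho> > 0\<close> by (intro mult_left_le) auto
      then show ?thesis
        using False \<open>finite A\<close> \<open>A \<noteq> {}\<close> by (simp add: \<kappa>_def \<alpha>_def card_S mult_ac)
    qed (use \<open>C > 0\<close> \<open>\<rho> > 0\<close> in simp)
    moreover have "T \<ge> 0" using s by (simp add: T_def sum_nonneg)
    ultimately have "T ^ 4 \<le> (C * \<rho> * real (card S)) * (4 * real M * T ^ 3)"
    proof -
      assume E: "energy S (\<lambda>x. \<Sum>\<theta>\<in>B. f \<theta> x) \<le> 4 * real M * \<kappa> * T ^ 3"
        and T4: "T ^ 4 \<le> L\<^sup>2 * real (card A) * energy S (\<lambda>x. \<Sum>\<theta>\<in>B. f \<theta> x)"
        and L: "L\<^sup>2 * real (card A) * \<kappa> \<le> C * \<rho> * real (card S)" and "T \<ge> 0"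
      note T4
      also have "L\<^sup>2 * real (card A) * energy S (\<lambda>x. \<Sum>\<theta>\<in>B. f \<theta> x) \<le> L\<^sup>2 * real (card A) * (4 * real M * \<kappa> * T ^ 3)"
        using E by (intro mult_left_mono) auto
      also have "\<dots> = (L\<^sup>2 * real (card A) * \<kappa>) * (4 * real M * T ^ 3)" by (simp add: mult_ac)
      also have "\<dots> \<le> (C * \<rho> * real (card S)) * (4 * real M * T ^ 3)"
        using L \<open>T \<ge> 0\<close> by (intro mult_right_mono) auto
      finally show ?thesis .
    qed
    then have T: "T \<le> \<rho> * real (card S)"
    proof (cases "T = 0")
      case False
      then have "T > 0" using \<open>T \<ge> 0\<close> by simp
      assume "T ^ 4 \<le> (C * \<rho> * real (card S)) * (4 * real M * T ^ 3)"
      then have "T * T ^ 3 \<le> (4 * real M * C * (\<rho> * real (card S))) * T ^ 3"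
        by (simp add: power4_eq_xxxx power3_eq_cube mult_ac)
      then have "T \<le> 4 * real M * C * (\<rho> * real (card S))"
        using \<open>T > 0\<close> by (simp only: mult_le_cancel_right_pos zero_less_power)
      also have "\<dots> \<le> 1 * (\<rho> * real (card S))"
        using \<open>\<rho> > 0\<close> by (intro mult_right_mono) (auto simp: C_def field_simps)
      finally show ?thesis by simp
    qed (use \<open>\<rho> > 0\<close> in simp)
    show "\<exists>\<Theta>\<^sub>g\<^sub>o\<^sub>o\<^sub>d \<subseteq> \<Theta>.
          (\<Sum>\<theta>\<in>\<Theta>\<^sub>g\<^sub>o\<^sub>o\<^sub>d. real (card (S \<inter> V \<theta>))) \<ge> (1 - \<rho>) * real (card S) \<and>
          (\<forall>\<theta>\<in>\<Theta>\<^sub>g\<^sub>o\<^sub>o\<^sub>d. \<forall>Y. Y \<noteq> {} \<longrightarrow> Y \<subseteq> S \<inter> V \<theta> \<longrightarrow>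
            (let \<alpha> = real (card D) / real (card A);
                 \<delta> = real (card Y) / real (card (S \<inter> V \<theta>))
             in \<exists>z \<in> Y + Y. z \<noteq> 0 \<and>
                  real (card (Y \<inter> (\<lambda>y. z - y) ` Y))
                    \<ge> C * \<sigma> powr (real CARD('d) - 3 + \<epsilon>)
                       * (\<delta> * \<rho> * \<alpha> / (fourier_L1_norm m A)\<^sup>2) * real (card Y)))"
    proof (intro exI[of _ "\<Theta> - B"] conjI ballI allI impI)
      have "sum s (\<Theta> - B) = real (card S) - T"
        using B \<Theta> by (simp add: sum_diff sum_s T_def)
      then show "(\<Sum>\<theta>\<in>\<Theta> - B. real (card (S \<inter> V \<theta>))) \<ge> (1 - \<rho>) * real (card S)"
        using T by (simp add: s_def[symmetric] algebra_simps)
    next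
      fix \<theta> Y assume "\<theta> \<in> \<Theta> - B" "Y \<noteq> {}" "Y \<subseteq> S \<inter> V \<theta>"
      \<comment> \<open>One bad set puts a cap into \<open>B\<close>, so outside \<open>B\<close>
        every admissible \<open>Y\<close> satisfies the conclusion.\<close>
      then have "\<not> bad \<theta> Y" by (auto simp: B_def)
      then obtain z where "z \<in> Y + Y" "z \<noteq> 0"
        "\<kappa> * (real (card Y) / s \<theta>) * real (card Y) \<le> real (card (Y \<inter> (\<lambda>y. z - y) ` Y))"
        using \<open>Y \<noteq> {}\<close> \<open>Y \<subseteq> S \<inter> V \<theta>\<close> by (auto simp: bad_def not_less)
      then show "let \<alpha> = real (card D) / real (card A);
                 \<delta> = real (card Y) / real (card (S \<inter> V \<theta>))
             in \<exists>z \<in> Y + Y. z \<noteq> 0 \<and>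
                  real (card (Y \<inter> (\<lambda>y. z - y) ` Y))
                    \<ge> C * \<sigma> powr (real CARD('d) - 3 + \<epsilon>)
                       * (\<delta> * \<rho> * \<alpha> / (fourier_L1_norm m A)\<^sup>2) * real (card Y)"
        unfolding Let_def by (intro bexI[of _ z]) (simp_all add: \<kappa>_def \<alpha>_def s_def L_def mult_ac)
    qed auto
  qed (use \<open>C > 0\<close> in auto)
qed

end
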